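(* Let $n\ge 3$ and $p\ge\frac{n+2}{n-2}$. Let $\psi\in C^2([0,+\infty))$ be positive on $(0,+\infty)$ with $\psi(0)=\psi''(0)=0$, $\psi'(0)=1$, $\psi'(r)\ge 0$ for every $r>0$, and $$\lim_{r\to+\infty}\frac{\psi'(r)}{\psi(r)}=l\in(0,+\infty],$$ and assume that the function $A(r):=\left(\int_0^r\psi(s)^{n-1}\,ds\right)^{\frac{p-1}{2(p+1)}}$ is convex on $[0,+\infty)$. If $l=+\infty$, assume in addition that $\left[\log\left(\frac{\psi'(r)}{\psi(r)}\right)\right]'=O(1)$ as $r\to+\infty$. Fix any $r_0\ge 0$ such that $\psi'>0$ on $[r_0,+\infty)$ (with $r_0=0$ allowed if $\psi'>0$ everywhere). Let $u$ be a radial positive solution of $-\Delta_g u=|u|^{p-1}u$ on $M$. (i) If $\frac{\psi}{\psi'}\in L^1(r_0,\infty)$, then $\lim_{r\to+\infty}u(r)\in(0,+\infty)$. (ii) If $\frac{\psi}{\psi'}\notin L^1(r_0,\infty)$, then $u$ vanishes at infinity with rate $$\lim_{r\to+\infty}\left(\int_{r_0}^r\frac{\psi(s)}{\psi'(s)}\,ds\right)^{1/(p-1)}u(r)=\left(\frac{n-1}{p-1}\right)^{1/(p-1)}.$$ In particular, when $l<+\infty$, $$\lim_{r\to+\infty}r^{1/(p-1)}u(r)=\left(\frac{l(n-1)}{p-1}\right)^{1/(p-1)}.$$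
   Context: $(M,g)$ is the $n$-dimensional Riemannian model with pole $o$ and metric $ds^2=dr^2+\psi(r)^2d\Theta^2$ in polar coordinates $(r,\Theta)\in(0,\infty)\times\mathbb{S}^{n-1}$ around $o$ ($M$ is diffeomorphic to $\mathbb{R}^n$). A function is radial if it depends only on $r$, the distance from $o$; for radial $f$, $\Delta_g f=f''+(n-1)\frac{\psi'}{\psi}f'$, so a radial solution $u$ of the equation satisfies $u''+(n-1)\frac{\psi'}{\psi}u'+|u|^{p-1}u=0$ for $r>0$, $u'(0)=0$. *)

theory Defs
  imports "HOL-Analysis.Analysis" "HOL-Library.Landau_Symbols"
begin

text \<open>
  \<open>\<psi>'\<close> and \<open>\<psi>''\<close> are the first and second derivative of a function of class \<open>C\<^sup>2\<close> on
  \<open>[0, \<infinity>)\<close>; at \<open>0\<close> the derivatives are one-sided. Values at negative arguments are irrelevant.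
\<close>
definition C2_halfline ::
    "(real \<Rightarrow> real) \<Rightarrow> (real \<Rightarrow> real) \<Rightarrow> (real \<Rightarrow> real) \<Rightarrow> bool" where
  "C2_halfline \<psi> \<psi>' \<psi>'' \<longleftrightarrow>
     (\<forall>r\<ge>0. (\<psi> has_real_derivative \<psi>' r) (at r within {0..})) \<and>
     (\<forall>r\<ge>0. (\<psi>' has_real_derivative \<psi>'' r) (at r within {0..})) \<and>
     continuous_on {0..} \<psi>''"

text \<open>
  The Riemannian model \<open>M\<close> is written in the global normal coordinates
  \<open>x = r \<Theta>\<close> (\<open>r \<ge> 0\<close>, \<open>\<Theta>\<close> in the unit sphere), which identify \<open>M\<close> with \<open>real ^ 'n\<close>, the pole
  \<open>o\<close> with \<open>0\<close> and the distance \<open>r\<close> from \<open>o\<close> with \<open>norm x\<close>.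
  For \<open>x \<noteq> 0\<close> the form \<open>dr\<^sup>2\<close> has the matrix \<open>x\<^sub>i x\<^sub>j / r\<^sup>2\<close>, and since the Euclidean metric is
  \<open>dr\<^sup>2 + r\<^sup>2 d\<Theta>\<^sup>2\<close>, the form \<open>d\<Theta>\<^sup>2\<close> has the matrix \<open>(\<delta>\<^sub>i\<^sub>j - x\<^sub>i x\<^sub>j / r\<^sup>2) / r\<^sup>2\<close>.
  At the pole, \<open>\<psi>(0) = 0\<close> and \<open>\<psi>'(0) = 1\<close> make the identity matrix the continuous extension.
\<close>
definition dr_sq :: "real ^ 'n \<Rightarrow> real ^ 'n ^ 'n" where
  "dr_sq x = (\<chi> i j. x $ i * x $ j / (norm x)\<^sup>2)"

definition dTheta_sq :: "real ^ 'n \<Rightarrow> real ^ 'n ^ 'n" where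
  "dTheta_sq x = (1 / (norm x)\<^sup>2) *\<^sub>R (mat 1 - dr_sq x)"

definition model_metric :: "(real \<Rightarrow> real) \<Rightarrow> real ^ 'n \<Rightarrow> real ^ 'n ^ 'n" where
  "model_metric \<psi> x =
     (if x = 0 then mat 1 else dr_sq x + (\<psi> (norm x))\<^sup>2 *\<^sub>R dTheta_sq x)"

definition partial :: "'n \<Rightarrow> (real ^ 'n \<Rightarrow> real) \<Rightarrow> real ^ 'n \<Rightarrow> real" where
  "partial i f x = deriv (\<lambda>t. f (x + t *\<^sub>R axis i 1)) 0"

definition laplace_beltrami ::
    "(real ^ 'n \<Rightarrow> real ^ 'n ^ 'n) \<Rightarrow> (real ^ 'n \<Rightarrow> real) \<Rightarrow> real ^ 'n \<Rightarrow> real" where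
  "laplace_beltrami g f x =
     (1 / sqrt (det (g x))) *
     (\<Sum>i\<in>UNIV. partial i
        (\<lambda>y. sqrt (det (g y)) * (\<Sum>j\<in>UNIV. matrix_inv (g y) $ i $ j * partial j f y)) x)"

definition C2_function :: "(real ^ 'n \<Rightarrow> real) \<Rightarrow> bool" where
  "C2_function f \<longleftrightarrow>
     (\<exists>(G :: real ^ 'n \<Rightarrow> real ^ 'n) (H :: real ^ 'n \<Rightarrow> real ^ 'n ^ 'n).
        (\<forall>x. (f has_derivative (\<lambda>h. G x \<bullet> h)) (at x)) \<and>
        (\<forall>x. (G has_derivative (\<lambda>h. H x *v h)) (at x)) \<and>
        continuous_on UNIV H)"

definition positive_solution :: "(real \<Rightarrow> real) \<Rightarrow> real \<Rightarrow> (real ^ 'n \<Rightarrow> real) \<Rightarrow> bool" where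
  "positive_solution \<psi> p v \<longleftrightarrow>
     C2_function v \<and> (\<forall>x. v x > 0) \<and>
     (\<forall>x. - laplace_beltrami (model_metric \<psi>) v x = \<bar>v x\<bar> powr (p - 1) * v x)"



text \<open>
  The facts below are a consistency check: away from the pole, the Laplace--Beltrami operator of
  the model metric acts on radial functions by \<open>f'' + (n - 1) (\<psi>' / \<psi>) f'\<close>.
\<close>

lemma model_metric_entry:
  fixes y :: "real^'n" assumes "y \<noteq> 0"
  shows "(model_metric \<psi> y) $ i $ j = (\<psi> (norm y)/norm y)^2 * (if i=j then 1 else 0) + (1 - (\<psi> (norm y)/norm y)^2) * (y$i * y$j / (norm y)^2)"
proof -
  define q where "q = y $ i * y $ j / (norm y)\<^sup>2"
  have "(model_metric \<psi> y) $ i $ j = q + (\<psi> (norm y))\<^sup>2 * (1 / (norm y)\<^sup>2 * ((if i = j then 1 else 0) - q))"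
    using assms by (simp add: model_metric_def dr_sq_def dTheta_sq_def mat_def q_def)
  thus ?thesis unfolding q_def[symmetric] by (simp add: power_divide left_diff_distrib right_diff_distrib)
qed

lemma det_rank_one_perturbation:
  fixes y :: "real^'n" and c :: real assumes "y \<noteq> 0"
  shows "det (\<chi> i j. c * (if i=j then 1 else 0) + (1 - c) * (y$i * y$j / (norm y)^2) :: real^'n^'n) = c ^ (CARD('n) - 1)"
proof -
  obtain k :: 'n where True by auto
  obtain f :: "real^'n \<Rightarrow> real^'n" where f: "orthogonal_transformation f" "f (axis k 1) = y /\<^sub>R norm y"
    using orthogonal_transformation_exists[of "axis k 1 :: real^'n" "y /\<^sub>R norm y"] assms by (auto simp: )
  define Q where "Q = matrix f"
  have Q: "orthogonal_matrix Q" "linear f" using f orthogonal_transformation_matrix Q_def by blast+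
  have col: "Q $ i $ k = y $ i / norm y" for i
    using f(2) by (simp add: Q_def matrix_def divide_inverse)
  have QQ: "(\<Sum>m\<in>UNIV. Q $ i $ m * Q $ j $ m) = (if i = j then 1 else 0)" for i j
  proof -
    have "(Q ** transpose Q) $ i $ j = (mat 1 :: real^'n^'n) $ i $ j" using Q by (simp add: orthogonal_matrix_def)
    thus ?thesis by (simp add: matrix_matrix_mult_def transpose_def mat_def)
  qed
  define D :: "real^'n^'n" where "D = (\<chi> i j. if i = j then (if i = k then 1 else c) else 0)"
  have QD: "(Q ** D) $ i $ m = Q $ i $ m * (if m = k then 1 else c)" for i m
    by (simp add: matrix_matrix_mult_def D_def if_distrib[of "\<lambda>x. _ * x"] cong: if_cong)
  have "(\<chi> i j. c * (if i=j then 1 else 0) + (1 - c) * (y$i * y$j / (norm y)^2) :: real^'n^'n) = Q ** D ** transpose Q"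
  proof (simp only: vec_eq_iff, intro allI)
    fix i j
    have "(Q ** D ** transpose Q) $ i $ j = (\<Sum>m\<in>UNIV. Q $ i $ m * (if m = k then 1 else c) * Q $ j $ m)"
      unfolding matrix_matrix_mult_def[of "Q ** D"] by (simp add: QD transpose_def)
    also have "\<dots> = (\<Sum>m\<in>UNIV. c * (Q $ i $ m * Q $ j $ m) + (if m = k then (1-c) * (Q $ i $ k * Q $ j $ k) else 0))"
      by (rule sum.cong) (auto simp: algebra_simps)
    also have "\<dots> = c * (if i = j then 1 else 0) + (1-c) * (Q $ i $ k * Q $ j $ k)"
      by (simp add: sum.distrib sum_distrib_left[symmetric] QQ)
    finally show "(\<chi> i j. c * (if i=j then 1 else 0) + (1 - c) * (y$i * y$j / (norm y)^2) :: real^'n^'n) $ i $ j = (Q ** D ** transpose Q) $ i $ j"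
      by (simp add: col power2_eq_square)
  qed
  moreover have "det Q * det Q = 1" using det_orthogonal_matrix[OF Q(1)] by auto
  moreover have "det D = (\<Prod>i\<in>UNIV. if i = k then 1 else c)"
    by (subst det_diagonal) (auto simp: D_def)
  moreover have "(\<Prod>i\<in>UNIV. if i = k then 1 else c) = c ^ (CARD('n) - 1)"
    by (simp add: prod.If_cases Compl_eq_Diff_UNIV card_Diff_singleton)
  ultimately show ?thesis by (simp add: det_mul)
qed

lemma det_model_metric:
  fixes y :: "real^'n" assumes "y \<noteq> 0"
  shows "det (model_metric \<psi> y) = ((\<psi> (norm y)/norm y)^2) ^ (CARD('n) - 1)"
proof -
  have "model_metric \<psi> y = (\<chi> i j. (\<psi> (norm y)/norm y)^2 * (if i=j then 1 else 0) + (1 - (\<psi> (norm y)/norm y)^2) * (y$i * y$j / (norm y)^2))"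
    by (simp only: vec_eq_iff model_metric_entry[OF assms] vec_lambda_beta) simp
  thus ?thesis by (simp only: det_rank_one_perturbation[OF assms])
qed

lemma sum_squares_norm: "(\<Sum>i\<in>UNIV. y$i * y$i) = (norm (y::real^'n))^2"
  by (simp add: power2_norm_eq_inner inner_vec_def)

lemma matrix_inv_model_metric_radial:
  fixes y :: "real^'n" assumes "y \<noteq> 0" "\<psi> (norm y) > 0"
  shows "(\<Sum>j\<in>UNIV. matrix_inv (model_metric \<psi> y) $ i $ j * y $ j) = y $ i"
proof -
  let ?g = "model_metric \<psi> y"
  have "det ?g \<noteq> 0" using assms by (simp add: det_model_metric)
  hence "invertible ?g" by (simp add: invertible_det_nz)
  hence inv: "matrix_inv ?g ** ?g = mat 1" unfolding matrix_inv_def invertible_def by (rule someI_ex[THEN conjunct2])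
  have "?g *v y = y"
  proof (simp only: vec_eq_iff, intro allI)
    fix i
    let ?c = "(\<psi> (norm y)/norm y)^2"
    have "(?g *v y) $ i = (\<Sum>j\<in>UNIV. (if i = j then ?c * y $ j else 0) + (1-?c) * y $ i / (norm y)^2 * (y$j * y$j))"
      unfolding matrix_vector_mult_def vec_lambda_beta model_metric_entry[OF assms(1)] by (rule sum.cong) (auto simp: algebra_simps)
    also have "\<dots> = ?c * y $ i + (1-?c) * y $ i / (norm y)^2 * (norm y)^2"
      by (simp only: sum.distrib sum_distrib_left[symmetric] sum_squares_norm) simp
    also have "\<dots> = ?c * y $ i + (1-?c) * y $ i" using assms(1) by simp
    also have "\<dots> = y $ i" by (simp only: left_diff_distrib)
    finally show "(?g *v y) $ i = y $ i" .
  qed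
  hence "matrix_inv ?g *v y = y" by (metis inv matrix_vector_mul_assoc matrix_vector_mul_lid)
  hence "(matrix_inv ?g *v y) $ i = y $ i" by simp
  thus ?thesis by (simp add: matrix_vector_mult_def)
qed

lemma norm_axis_derivative:
  fixes y :: "real^'n" assumes "y \<noteq> 0"
  shows "((\<lambda>t. norm (y + t *\<^sub>R axis j 1)) has_real_derivative y$j / norm y) (at 0)"
proof -
  have "((\<lambda>t. norm (y + t *\<^sub>R axis j 1)) has_derivative (\<lambda>h. (h *\<^sub>R axis j 1) \<bullet> sgn y)) (at 0)"
    by (rule has_derivative_compose[where g=norm and f="\<lambda>t. y + t *\<^sub>R axis j 1", THEN has_derivative_eq_rhs])
       (auto intro!: derivative_eq_intros has_derivative_norm assms simp: inner_commute)
  thus ?thesis unfolding has_field_derivative_def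
    by (rule has_derivative_eq_rhs) (auto simp: sgn_div_norm inner_axis inner_axis' field_simps)
qed

lemma partial_radial:
  fixes y :: "real^'n" assumes "y \<noteq> 0" "(U has_real_derivative d) (at (norm y))"
  shows "partial j (\<lambda>y. U (norm y)) y = d * (y$j / norm y)"
  unfolding partial_def
  by (rule DERIV_imp_deriv, rule DERIV_chain2[where g="\<lambda>t. norm (y + t *\<^sub>R axis j 1)" and f=U])
     (use assms norm_axis_derivative in auto)

lemma laplace_beltrami_radial:
  fixes x :: "real^'n"
  assumes x: "x \<noteq> 0" and pos: "\<And>r. r > 0 \<Longrightarrow> \<psi> r > 0"
    and psi: "(\<psi> has_real_derivative d) (at (norm x))"
    and U: "\<And>r. r > 0 \<Longrightarrow> (U has_real_derivative U1 r) (at r)"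
    and U1: "(U1 has_real_derivative U2) (at (norm x))"
  shows "laplace_beltrami (model_metric \<psi>) (\<lambda>x. U (norm x)) x =
     U2 + (real CARD('n) - 1) * (d / \<psi> (norm x)) * U1 (norm x)"
proof -
  define m where "m = CARD('n) - 1"
  have m: "real CARD('n) = real m + 1" using zero_less_card_finite[where 'a='n] unfolding m_def by linarith
  define r where "r = norm x"
  have r: "r > 0" using x r_def by simp
  define P where "P r = (\<psi> r / r)^m * (U1 r / r)" for r
  have flux: "sqrt (det (model_metric \<psi> y)) * (\<Sum>j\<in>UNIV. matrix_inv (model_metric \<psi> y) $ i $ j * partial j (\<lambda>x. U (norm x)) y) = P (norm y) * y $ i"
    if y: "y \<noteq> 0" for y :: "real^'n" and i
  proof -
    have p: "\<psi> (norm y) > 0" using pos y by simp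
    have "(\<Sum>j\<in>UNIV. matrix_inv (model_metric \<psi> y) $ i $ j * partial j (\<lambda>x. U (norm x)) y) = (U1 (norm y) / norm y) * (\<Sum>j\<in>UNIV. matrix_inv (model_metric \<psi> y) $ i $ j * y $ j)"
      unfolding sum_distrib_left by (rule sum.cong) (auto simp: partial_radial[OF y U] y)
    also have "\<dots> = U1 (norm y) / norm y * y $ i" by (simp only: matrix_inv_model_metric_radial[of y \<psi>, OF y p])
    finally have "(\<Sum>j\<in>UNIV. matrix_inv (model_metric \<psi> y) $ i $ j * partial j (\<lambda>x. U (norm x)) y) = U1 (norm y) / norm y * y $ i" .
    moreover have "sqrt (det (model_metric \<psi> y)) = (\<psi> (norm y) / norm y)^m"
      using p y by (simp add: det_model_metric m_def real_sqrt_power)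
    ultimately show ?thesis by (simp add: P_def)
  qed
  define P' where "P' = of_nat m * (\<psi> r / r)^(m-1) * ((d * r - \<psi> r) / r^2) * (U1 r / r) + (\<psi> r / r)^m * ((U2 * r - U1 r)/r^2)"
  have P': "(P has_real_derivative P') (at r)"
  proof -
    have 1: "((\<lambda>r. \<psi> r / r) has_real_derivative (d * r - \<psi> r) / r^2) (at r)"
      using psi r unfolding r_def[symmetric] by (auto intro!: derivative_eq_intros simp: power2_eq_square)
    have 2: "((\<lambda>r. U1 r / r) has_real_derivative (U2 * r - U1 r) / r^2) (at r)"
      using U1 r unfolding r_def[symmetric] by (auto intro!: derivative_eq_intros simp: power2_eq_square)
    have "((\<lambda>r. (\<psi> r / r)^m) has_real_derivative of_nat m * (\<psi> r / r)^(m-1) * ((d * r - \<psi> r) / r^2)) (at r)"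
      using DERIV_power[OF 1, of m] by (simp add: mult_ac)
    from DERIV_mult[OF this 2] show ?thesis unfolding P_def[abs_def] P'_def by (simp only: add.commute mult_ac)
  qed
  have "partial i (\<lambda>y. sqrt (det (model_metric \<psi> y)) * (\<Sum>j\<in>UNIV. matrix_inv (model_metric \<psi> y) $ i $ j * partial j (\<lambda>x. U (norm x)) y)) x
      = P' / r * (x$i * x$i) + P r" for i
  proof -
    have ev: "\<forall>\<^sub>F t in nhds 0. x + t *\<^sub>R axis i 1 \<noteq> 0"
    proof -
      have "((\<lambda>t. x + t *\<^sub>R axis i 1) \<longlongrightarrow> x + 0 *\<^sub>R axis i 1) (nhds (0::real))" 
        by (intro tendsto_intros filterlim_ident) 
      then show ?thesis using x tendsto_imp_eventually_ne by fastforce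
    qed
    have "((\<lambda>t. P (norm (x + t *\<^sub>R axis i 1)) * (x + t *\<^sub>R axis i 1) $ i) has_real_derivative P' / r * (x$i * x$i) + P r) (at 0)"
    proof -
      have "((\<lambda>t. P (norm (x + t *\<^sub>R axis i 1))) has_real_derivative P' * (x$i / norm x)) (at 0)"
        by (rule DERIV_chain2) (use P' norm_axis_derivative[OF x] in \<open>auto simp: r_def\<close>)
      moreover have "((\<lambda>t. (x + t *\<^sub>R axis i 1) $ i) has_real_derivative 1) (at 0)"
        by (auto intro!: derivative_eq_intros simp: axis_def)
      ultimately have "((\<lambda>t. P (norm (x + t *\<^sub>R axis i 1)) * (x + t *\<^sub>R axis i 1) $ i) has_real_derivative
         P' * (x$i / norm x) * (x + 0 *\<^sub>R axis i 1) $ i + 1 * P (norm (x + 0 *\<^sub>R axis i 1))) (at 0)"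
        by (rule DERIV_mult)
      thus ?thesis by (simp add: r_def mult.assoc)
    qed
    then have "((\<lambda>t. (\<lambda>y. sqrt (det (model_metric \<psi> y)) * (\<Sum>j\<in>UNIV. matrix_inv (model_metric \<psi> y) $ i $ j * partial j (\<lambda>x. U (norm x)) y)) (x + t *\<^sub>R axis i 1)) has_real_derivative P' / r * (x$i * x$i) + P r) (at 0)"
      by (subst DERIV_cong_ev[OF refl _ refl]) (use ev in \<open>auto elim!: eventually_mono simp: flux\<close>)
    thus ?thesis unfolding partial_def[of i] by (rule DERIV_imp_deriv)
  qed
  hence "laplace_beltrami (model_metric \<psi>) (\<lambda>x. U (norm x)) x = 1 / sqrt (det (model_metric \<psi> x)) * (\<Sum>i\<in>UNIV. P' / r * (x$i * x$i) + P r)"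
    unfolding laplace_beltrami_def by simp
  also have "(\<Sum>i\<in>UNIV. P' / r * (x$i * x$i) + P r) = P' * r + (real m + 1) * P r"
  proof -
    have "(\<Sum>i\<in>UNIV. P' / r * (x$i * x$i) + P r) = P' / r * (\<Sum>i\<in>UNIV. x$i * x$i) + (\<Sum>i\<in>(UNIV :: 'n set). P r)"
      by (simp only: sum.distrib sum_distrib_left)
    also have "\<dots> = P' / r * r\<^sup>2 + real CARD('n) * P r"
      by (simp only: sum_squares_norm r_def[symmetric] sum_constant)
    finally show ?thesis using r by (simp add: m power2_eq_square)
  qed
  also have "sqrt (det (model_metric \<psi> x)) = (\<psi> r / r)^m"
    using pos[OF r] r x by (simp add: det_model_metric m_def real_sqrt_power r_def)
  also have "1 / (\<psi> r / r)^m * (P' * r + (real m + 1) * P r) = U2 + real m * (d / \<psi> r) * U1 r"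
  proof (cases m)
    case 0
    have "(U2 * r - U1 r) / r\<^sup>2 * r = U2 - U1 r / r" using r by (simp add: diff_divide_distrib left_diff_distrib power2_eq_square)
    thus ?thesis using 0 by (simp add: P'_def P_def)
  next
    case (Suc k)
    define a where "a = \<psi> r / r"
    have a: "a > 0" "\<psi> r = a * r" using pos[OF r] r by (auto simp: a_def)
    define w where "w = U1 r / r"
    have w: "U1 r = w * r" using r by (simp add: w_def)
    have q: "(d * r - \<psi> r) / r\<^sup>2 = (d - a) / r" "(U2 * r - U1 r) / r\<^sup>2 = (U2 - w) / r"
      unfolding a(2) w left_diff_distrib[symmetric] using r by (simp_all add: power2_eq_square)
    have "P' = real m * a ^ k * ((d - a) / r) * w + a * a ^ k * ((U2 - w) / r)"
      unfolding P'_def q a_def[symmetric] w_def[symmetric] Suc by simp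
    hence "P' * r = real m * a ^ k * (d - a) * w + a * a ^ k * (U2 - w)"
      using r by (simp add: distrib_right)
    moreover have "P r = a * a ^ k * w"
      unfolding P_def a_def[symmetric] w_def[symmetric] Suc by simp
    ultimately have "P' * r + (real m + 1) * P r = a ^ k * (real m * d * w + a * U2)"
      by (simp only: left_diff_distrib right_diff_distrib distrib_left distrib_right) (simp add: mult_ac)
    hence "1 / (\<psi> r / r) ^ m * (P' * r + (real m + 1) * P r) = (real m * d * w + a * U2) / a"
      unfolding a_def[symmetric] Suc using a(1) by simp
    also have "\<dots> = U2 + real m * (d * w / a)"
      using a(1) by (simp add: add_divide_distrib mult.assoc)
    also have "d * w / a = d / \<psi> r * U1 r"
      unfolding a(2) w using r by simp
    finally show ?thesis by (simp add: mult.assoc)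
  qed
  finally show ?thesis by (simp add: m r_def)
qed

end

theory Submission
  imports Defs
begin

text \<open>
  Write \<open>N = n - 1\<close>, \<open>h = \<psi>' / \<psi>\<close>, \<open>m = \<psi> ^ N\<close> and let \<open>V r\<close> be the integral of \<open>m\<close> over
  \<open>{0..r}\<close>. Along a ray the equation becomes \<open>u'' + N h u' + u\<^sup>p = 0\<close>, that is
  \<open>(m u')' = - m u\<^sup>p\<close>, so \<open>u\<close> is strictly decreasing.

  A positive solution can a priori decay in two ways: slowly, with friction balancing the source
  (\<open>N h u' \<approx> - u\<^sup>p\<close>), or fast, with \<open>u'' \<approx> - N h u'\<close> and hence \<open>- u' / u \<approx> N h\<close>. Convexity of
  \<open>V powr ((p - 1) / (2 (p + 1)))\<close> excludes the second one. It says
  \<open>(p + 3) / (2 (p + 1)) m \<le> V N h\<close> (\<open>volume_growth_of_convex_powr\<close>), which is exactly the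
  condition under which the derivative of the Pohozaev energy
  \<open>V (u'\<^sup>2 / 2 + u powr (p + 1) / (p + 1)) + m u u' / (p + 1)\<close> is nonpositive. This energy vanishes at
  the pole, so it is nonpositive everywhere, and dropping its nonnegative potential term leaves
  \<open>- u' / u \<le> 4 / (p + 3) N h\<close> (\<open>pohozaev_decay_bound\<close>). The factor \<open>4 / (p + 3)\<close> is less
  than \<open>1\<close> because \<open>p > 1\<close>; this gap below the rate of fast decay drives the asymptotic analysis.

  The functions \<open>w = - u' / u\<close> and \<open>\<zeta> = - u' / u powr p\<close> satisfy
  \<open>w' = u powr (p - 1) - (N h - w) w\<close> and \<open>\<zeta>' = 1 - (N h - p w) \<zeta>\<close>. A linear equation
  \<open>y' = A - B y\<close> with \<open>B\<close> bounded away from \<open>0\<close> forces \<open>y\<close> to follow the quotient \<open>A / B\<close>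
  (\<open>linear_ode_tendsto_quotient\<close>). By the gap, this first gives that \<open>w\<close> is negligible
  compared with \<open>h\<close>, and then that \<open>h \<zeta>\<close> tends to \<open>1 / N\<close>. If \<open>h\<close> has a finite limit, the
  argument uses that \<open>u\<close> vanishes at infinity and applies to \<open>w\<close> and \<open>\<zeta>\<close> themselves; if \<open>h\<close>
  tends to infinity, it applies to \<open>w / h\<close> and \<open>h \<zeta>\<close>, where the extra terms involve only
  \<open>h' / h\<close>, which is bounded.

  Finally \<open>(u powr (1 - p))' = (p - 1) \<zeta>\<close>, so up to the factor \<open>(p - 1) / N\<close> the function
  \<open>u powr (1 - p)\<close> grows like the integral of \<open>1 / h = \<psi> / \<psi>'\<close>. If this integral converges,
  \<open>u powr (1 - p)\<close> is bounded and the limit of \<open>u\<close> is positive (\<open>u_tendsto_positive\<close>); if it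
  diverges, l'Hospital's rule gives the rate (\<open>u_rate\<close>).
\<close>

section \<open>Linear first-order equations and monotone limits\<close>

lemma DERIV_integral_upper_limit:
  fixes f :: "real \<Rightarrow> real"
  assumes "continuous_on {a..} f" "a < r"
  shows "((\<lambda>x. integral {a..x} f) has_real_derivative f r) (at r)"
proof -
  have "((\<lambda>x. integral {a..x} f) has_real_derivative f r) (at r within {a..r+1})"
    using assms by (intro integral_has_real_derivative continuous_on_subset[OF assms(1)]) auto
  thus ?thesis using assms(2) by (simp add: at_within_Icc_at)
qed

text \<open>
  With an antiderivative \<open>F\<close> of \<open>B\<close>, the equation reads \<open>(exp F y)' = exp F A\<close>, while
  \<open>(exp F)' = exp F B\<close>. So \<open>y = exp F y / exp F\<close> is a quotient whose derivatives have the quotient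
  \<open>A / B\<close>, and since \<open>exp F\<close> tends to infinity, l'Hospital's rule applies.
\<close>
lemma linear_ode_tendsto_quotient:
  fixes y A B :: "real \<Rightarrow> real"
  assumes deriv: "\<And>r. r > R \<Longrightarrow> (y has_real_derivative A r - B r * y r) (at r)"
    and cont: "continuous_on {R<..} B"
    and \<beta>: "\<beta> > 0" "\<forall>\<^sub>F r in at_top. B r \<ge> \<beta>"
    and lim: "((\<lambda>r. A r / B r) \<longlongrightarrow> c) at_top"
  shows "(y \<longlongrightarrow> c) at_top"
proof -
  obtain T where T: "\<And>r. r \<ge> T \<Longrightarrow> B r \<ge> \<beta>"
    using \<beta>(2) by (auto simp: eventually_at_top_linorder)
  (* Starting at R + 1 keeps B continuous on the closed half-line from S. *)
  define S where "S = max T (R + 1)"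
  have S: "S > R" "\<And>r. r \<ge> S \<Longrightarrow> B r \<ge> \<beta>" using T by (auto simp: S_def)
  define F where "F r = integral {S..r} B" for r
  have cont': "continuous_on {S..} B" using cont S(1) by (auto elim: continuous_on_subset)
  have F: "(F has_real_derivative B r) (at r)" if "r > S" for r
    unfolding F_def using DERIV_integral_upper_limit[OF cont' that] .
  have F_ge: "\<beta> * (r - S) \<le> F r" if "r \<ge> S" for r
  proof -
    have "integral {S..r} (\<lambda>_. \<beta>) \<le> integral {S..r} B"
      using S(2) by (intro integral_le integrable_continuous_interval continuous_on_subset[OF cont']) auto
    thus ?thesis using that by (simp add: F_def mult.commute)
  qed
  have "filterlim (\<lambda>r. r - S) at_top at_top"
    using filterlim_tendsto_add_at_top[OF tendsto_const[of "- S"] filterlim_ident] by simp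
  hence "filterlim (\<lambda>r. \<beta> * (r - S)) at_top at_top"
    by (rule filterlim_tendsto_pos_mult_at_top[OF tendsto_const \<beta>(1)])
  hence "filterlim F at_top at_top"
    by (rule filterlim_at_top_mono) (use F_ge in \<open>auto simp: eventually_at_top_linorder\<close>)
  hence \<mu>: "filterlim (\<lambda>r. exp (F r)) at_top at_top"
    by (rule filterlim_compose[OF exp_at_top])
  have "((\<lambda>r. exp (F r) * y r / exp (F r)) \<longlongrightarrow> c) at_top"
  proof (rule lhospital_at_top_at_top[where f' = "\<lambda>r. exp (F r) * A r" and g' = "\<lambda>r. exp (F r) * B r"])
    show "\<forall>\<^sub>F r in at_top. exp (F r) * B r \<noteq> 0"
      using \<beta>(2) by eventually_elim (use \<beta>(1) in auto)
    show "\<forall>\<^sub>F r in at_top. ((\<lambda>r. exp (F r) * y r) has_real_derivative exp (F r) * A r) (at r)"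
      using eventually_gt_at_top[of S]
    proof eventually_elim
      case (elim r)
      show ?case using S(1) elim
        by (auto intro!: derivative_eq_intros F deriv simp: algebra_simps)
    qed
    show "\<forall>\<^sub>F r in at_top. ((\<lambda>r. exp (F r)) has_real_derivative exp (F r) * B r) (at r)"
      using eventually_gt_at_top[of S] by eventually_elim (auto intro!: derivative_eq_intros F)
  qed (use \<mu> lim in auto)
  thus ?thesis by simp
qed

lemma tendsto_zero_of_linear_ode:
  fixes y A B :: "real \<Rightarrow> real"
  assumes deriv: "\<And>r. r > R \<Longrightarrow> (y has_real_derivative A r - B r * y r) (at r)"
    and cont: "continuous_on {R<..} B"
    and \<beta>: "\<beta> > 0" "\<forall>\<^sub>F r in at_top. B r \<ge> \<beta>"
    and lim: "(A \<longlongrightarrow> 0) at_top"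
  shows "(y \<longlongrightarrow> 0) at_top"
proof (rule linear_ode_tendsto_quotient[OF deriv cont \<beta>])
  have "((\<lambda>r. \<bar>A r\<bar> / \<beta>) \<longlongrightarrow> \<bar>0\<bar> / \<beta>) at_top" using \<beta>(1) by (intro tendsto_intros lim) auto
  hence "((\<lambda>r. \<bar>A r\<bar> / \<beta>) \<longlongrightarrow> 0) at_top" by simp
  thus "((\<lambda>r. A r / B r) \<longlongrightarrow> 0) at_top"
    by (rule Lim_null_comparison[rotated])
       (use \<beta>(2) in eventually_elim, use \<beta>(1) in \<open>auto simp: frac_le\<close>)
qed

lemma antimono_bounded_below_tendsto_at_top:
  fixes f :: "real \<Rightarrow> real"
  assumes anti: "\<And>r s. a < r \<Longrightarrow> r \<le> s \<Longrightarrow> f s \<le> f r" and lb: "\<And>r. r > a \<Longrightarrow> b \<le> f r"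
  obtains L where "(f \<longlongrightarrow> L) at_top" "b \<le> L"
proof
  define L where "L = Inf (f ` {a<..})"
  have bdd: "bdd_below (f ` {a<..})" using lb by (auto intro!: bdd_belowI2)
  show "b \<le> L" unfolding L_def using lb by (intro cInf_greatest) auto
  show "(f \<longlongrightarrow> L) at_top"
  proof (rule decreasing_tendsto)
    show "\<forall>\<^sub>F r in at_top. L \<le> f r"
      using eventually_gt_at_top[of a]
      by eventually_elim (use bdd in \<open>auto simp: L_def intro!: cInf_lower\<close>)
    fix x assume "L < x"
    then obtain r where r: "r > a" "f r < x" unfolding L_def
      by (subst (asm) cInf_less_iff) (use bdd in auto)
    show "\<forall>\<^sub>F s in at_top. f s < x"
      using eventually_ge_at_top[of r] by eventually_elim (use anti r in force)
  qed
qed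

section \<open>Asymptotics of the radial equation without fast decay\<close>

text \<open>
  The radial equation for a general drift coefficient \<open>h\<close>. The hypothesis \<open>slow\<close> keeps the
  logarithmic decay rate of \<open>u\<close> a fixed factor \<open>\<kappa> < 1\<close> below the rate \<open>N h\<close> of fast decay.
\<close>
locale radial_lane_emden =
  fixes N p \<kappa> :: real and h u u' :: "real \<Rightarrow> real"
  assumes N: "N > 0" and p: "p > 1"
    and h_pos: "\<And>r. r > 0 \<Longrightarrow> h r > 0"
    and h_cont: "continuous_on {0<..} h"
    and u_pos: "\<And>r. r > 0 \<Longrightarrow> u r > 0"
    and u'_neg: "\<And>r. r > 0 \<Longrightarrow> u' r < 0"
    and DERIV_u: "\<And>r. r > 0 \<Longrightarrow> (u has_real_derivative u' r) (at r)"
    and DERIV_u': "\<And>r. r > 0 \<Longrightarrow> (u' has_real_derivative - (N * h r * u' r + u r powr p)) (at r)"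
    and \<kappa>: "\<kappa> < 1" and slow: "\<And>r. r > 0 \<Longrightarrow> - u' r \<le> \<kappa> * (N * h r * u r)"
begin

text \<open>
  The logarithmic decay rate of \<open>u\<close>. Its equation is of Riccati type; it is treated as a linear
  one by counting one factor \<open>w\<close> in \<open>w\<^sup>2\<close> as part of the coefficient, which the bound on \<open>w\<close>
  controls.
\<close>
definition w :: "real \<Rightarrow> real" where "w r = - u' r / u r"

text \<open>
  Up to the factor \<open>p - 1\<close>, this is the derivative of \<open>u powr (1 - p)\<close>. The balance
  \<open>N h u' \<approx> - u\<^sup>p\<close> of slow decay says that \<open>h \<zeta>\<close> is close to \<open>1 / N\<close>.
\<close>
definition \<zeta> :: "real \<Rightarrow> real" where "\<zeta> r = - u' r / u r powr p"

lemma w_le: assumes "r > 0" shows "w r \<le> \<kappa> * (N * h r)"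
  using u_pos[OF assms] u'_neg[OF assms] slow[OF assms] by (auto simp: w_def field_simps)

lemma u_powr_p_eq: "r > 0 \<Longrightarrow> u r powr p = u r powr (p - 1) * u r"
  using u_pos[of r] powr_add[of "u r" "p - 1" 1] by simp

lemma DERIV_w:
  assumes "r > 0"
  shows "(w has_real_derivative u r powr (p - 1) - (N * h r - w r) * w r) (at r)"
proof -
  have u: "u r \<noteq> 0" using u_pos[OF assms] by simp
  note * = DERIV_divide[OF DERIV_minus[OF DERIV_u'[OF assms]] DERIV_u[OF assms] u]
  show ?thesis unfolding w_def[abs_def]
    by (rule DERIV_cong[OF *]) (use u in \<open>simp add: u_powr_p_eq[OF assms] field_simps\<close>)
qed

lemma DERIV_\<zeta>:
  assumes "r > 0"
  shows "(\<zeta> has_real_derivative 1 - (N * h r - p * w r) * \<zeta> r) (at r)"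
proof -
  have u: "u r > 0" using u_pos[OF assms] by simp
  have "((\<lambda>r. u r powr p) has_real_derivative p * u r powr (p - 1) * u' r) (at r)"
    using DERIV_fun_powr[OF DERIV_u[OF assms] u, of p] by simp
  from DERIV_divide[OF DERIV_minus[OF DERIV_u'[OF assms]] this]
  have "((\<lambda>r. - u' r / u r powr p) has_real_derivative
      (- (- (N * h r * u' r + u r powr p)) * u r powr p - - u' r * (p * u r powr (p - 1) * u' r)) /
      (u r powr p * u r powr p)) (at r)" using u by simp
  thus ?thesis unfolding \<zeta>_def[abs_def] w_def
    by (rule DERIV_cong) (use u in \<open>simp add: u_powr_p_eq[OF assms] field_simps\<close>)
qed

lemma w_cont: "continuous_on {0<..} w"
  by (rule DERIV_continuous_on, rule DERIV_subset[OF DERIV_w]) auto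

lemma u_antimono: assumes "0 < r" "r \<le> s" shows "u s \<le> u r"
proof (rule DERIV_nonpos_imp_nonincreasing[OF assms(2)])
  fix x assume "r \<le> x"
  hence "x > 0" using assms(1) by simp
  thus "\<exists>y. (u has_real_derivative y) (at x) \<and> y \<le> 0"
    using DERIV_u u'_neg by (intro exI[of _ "u' x"]) (auto intro: less_imp_le)
qed

lemma N_h_minus_w: "r > 0 \<Longrightarrow> (1 - \<kappa>) * (N * h r) \<le> N * h r - w r"
  using w_le[of r] by (simp add: algebra_simps)

text \<open>
  If \<open>u\<close> had a positive limit \<open>L\<close>, the linear equation for \<open>- u'\<close> would make \<open>- u'\<close> tend to
  \<open>L powr p / (N l) > 0\<close>, and then \<open>u\<close> would decrease at least linearly.
\<close>
lemma u_tendsto_0: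
  assumes "l > 0" "(h \<longlongrightarrow> l) at_top"
  shows "(u \<longlongrightarrow> 0) at_top"
proof -
  obtain L where L: "(u \<longlongrightarrow> L) at_top" "0 \<le> L"
    by (rule antimono_bounded_below_tendsto_at_top[of 0 u 0])
       (use u_antimono u_pos in \<open>auto intro: less_imp_le\<close>)
  have "L = 0"
  proof (rule ccontr)
    assume "L \<noteq> 0"
    hence "L > 0" using L by simp
    have "\<forall>\<^sub>F r in at_top. N * h r > N * l / 2"
      by (rule order_tendstoD[OF tendsto_mult_left[OF assms(2)]]) (use N assms in simp)
    hence ev: "\<forall>\<^sub>F r in at_top. N * l / 2 \<le> N * h r" by (rule eventually_mono) simp
    have lim: "((\<lambda>r. u r powr p / (N * h r)) \<longlongrightarrow> L powr p / (N * l)) at_top"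
      using N assms \<open>L > 0\<close> by (auto intro!: tendsto_intros L)
    have D: "((\<lambda>r. - u' r) has_real_derivative u r powr p - N * h r * - u' r) (at r)" if "r > 0" for r
      using DERIV_minus[OF DERIV_u'[OF that]] by simp
    have "continuous_on {0<..} (\<lambda>r. N * h r)" by (intro continuous_on_mult_left h_cont)
    moreover have "N * l / 2 > 0" using N assms(1) by simp
    ultimately have "((\<lambda>r. - u' r) \<longlongrightarrow> L powr p / (N * l)) at_top"
      by (rule linear_ode_tendsto_quotient[where R=0 and A="\<lambda>r. u r powr p" and B="\<lambda>r. N * h r", OF _ _ _ ev lim, rotated]) (rule D)
    from tendsto_minus[OF this] have lim_u': "(u' \<longlongrightarrow> - (L powr p / (N * l))) at_top" by simp
    have "\<forall>\<^sub>F r in at_top. (u has_real_derivative u' r) (at r)"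
      using eventually_gt_at_top[of 0] by eventually_elim (rule DERIV_u)
    hence "((\<lambda>r. u r / r) \<longlongrightarrow> - (L powr p / (N * l))) at_top"
      by (rule lhospital_at_top_at_top[OF filterlim_ident, where g'="\<lambda>_. 1", rotated])
         (use lim_u' in auto)
    moreover have "((\<lambda>r. u r / r) \<longlongrightarrow> 0) at_top"
      by (rule tendsto_divide_0[OF L(1)]) (simp add: filterlim_at_top_imp_at_infinity filterlim_ident)
    ultimately have "- (L powr p / (N * l)) = 0" by (rule tendsto_unique[rotated]) simp
    thus False using \<open>L > 0\<close> N assms by simp
  qed
  thus ?thesis using L by simp
qed

text \<open>
  The coefficient \<open>N h - w\<close> in the equation for \<open>w\<close> stays positive by the gap, and the source
  \<open>u powr (p - 1)\<close> vanishes; hence \<open>w\<close> vanishes too. So the coefficient \<open>N h - p w\<close> in the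
  equation for \<open>\<zeta>\<close> tends to \<open>N l\<close>.
\<close>
lemma h_\<zeta>_tendsto_finite:
  assumes l: "l > 0" "(h \<longlongrightarrow> l) at_top"
  shows "((\<lambda>r. h r * \<zeta> r) \<longlongrightarrow> 1 / N) at_top"
proof -
  have "\<forall>\<^sub>F r in at_top. h r > l / 2" by (rule order_tendstoD[OF l(2)]) (use l in simp)
  hence ev: "\<forall>\<^sub>F r in at_top. N * h r - w r \<ge> (1 - \<kappa>) * (N * (l / 2))"
    using eventually_gt_at_top[of 0]
  proof eventually_elim
    case (elim r)
    have "(1 - \<kappa>) * (N * (l / 2)) \<le> (1 - \<kappa>) * (N * h r)"
      using elim \<kappa> N by (intro mult_left_mono) auto
    thus ?case using N_h_minus_w[of r] elim by linarith
  qed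
  have lim: "((\<lambda>r. u r powr (p - 1)) \<longlongrightarrow> 0) at_top"
    by (rule tendsto_zero_powrI[OF u_tendsto_0[OF l] tendsto_const])
       (use p u_pos in \<open>auto intro!: eventually_mono[OF eventually_gt_at_top[of 0]] less_imp_le\<close>)
  have "continuous_on {0<..} (\<lambda>r. N * h r - w r)"
    by (intro continuous_on_diff continuous_on_mult_left h_cont w_cont)
  moreover have "(1 - \<kappa>) * (N * (l / 2)) > 0" using \<kappa> N l by simp
  ultimately have w0: "(w \<longlongrightarrow> 0) at_top"
    by (rule tendsto_zero_of_linear_ode[where R=0 and A="\<lambda>r. u r powr (p - 1)"
          and B="\<lambda>r. N * h r - w r", OF _ _ _ ev lim, rotated]) (rule DERIV_w)
  have B: "((\<lambda>r. N * h r - p * w r) \<longlongrightarrow> N * l - p * 0) at_top" by (intro tendsto_intros w0 l)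
  have "\<forall>\<^sub>F r in at_top. N * h r - p * w r > N * l / 2" by (rule order_tendstoD[OF B]) (use l N in simp)
  hence ev': "\<forall>\<^sub>F r in at_top. N * l / 2 \<le> N * h r - p * w r" by (rule eventually_mono) simp
  have lim': "((\<lambda>r. 1 / (N * h r - p * w r)) \<longlongrightarrow> 1 / (N * l)) at_top"
    using tendsto_divide[OF tendsto_const B, of 1] l N by simp
  have "continuous_on {0<..} (\<lambda>r. N * h r - p * w r)"
    by (intro continuous_on_diff continuous_on_mult_left h_cont w_cont)
  moreover have "N * l / 2 > 0" using l N by simp
  ultimately have "(\<zeta> \<longlongrightarrow> 1 / (N * l)) at_top"
    by (rule linear_ode_tendsto_quotient[where R=0 and A="\<lambda>_. 1"
          and B="\<lambda>r. N * h r - p * w r", OF _ _ _ ev' lim', rotated]) (rule DERIV_\<zeta>)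
  from tendsto_mult[OF l(2) this] show ?thesis using l by simp
qed

text \<open>
  Here \<open>u\<close> may have a positive limit, but the source in the equation for \<open>w / h\<close> is
  \<open>u powr (p - 1) / h\<close>, which vanishes because \<open>u\<close> is bounded and \<open>h\<close> tends to infinity.
  The price of dividing or multiplying by \<open>h\<close> is a term \<open>h' / h\<close> in the coefficients. It is bounded, hence negligible
  compared with \<open>h\<close>.
\<close>
lemma h_\<zeta>_tendsto_infinite:
  assumes h: "filterlim h at_top at_top"
    and h': "\<And>r. r > 0 \<Longrightarrow> (h has_real_derivative h' r) (at r)" "continuous_on {0<..} h'"
    and C: "\<forall>\<^sub>F r in at_top. \<bar>h' r / h r\<bar> \<le> C"
  shows "((\<lambda>r. h r * \<zeta> r) \<longlongrightarrow> 1 / N) at_top"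
proof -
  have h_nz: "\<And>r. r > 0 \<Longrightarrow> h r \<noteq> 0" using h_pos by force
  have inv_h: "((\<lambda>r. K / h r) \<longlongrightarrow> 0) at_top" for K
    by (rule tendsto_divide_0[OF tendsto_const]) (rule filterlim_at_top_imp_at_infinity[OF h])
  have \<kappa>': "(1 - \<kappa>) * N > 0" using \<kappa> N by simp
  (* The threshold for h pays for the term h' / h, which may be as small as - C, and leaves 1. *)
  have "\<forall>\<^sub>F r in at_top. h r \<ge> (1 + C) / ((1 - \<kappa>) * N)"
    using h by (simp add: filterlim_at_top)
  hence ev: "\<forall>\<^sub>F r in at_top. N * h r - w r + h' r / h r \<ge> 1"
    using eventually_gt_at_top[of 0] C
  proof eventually_elim
    case (elim r)
    have "1 + C \<le> (1 - \<kappa>) * N * h r" using elim \<kappa>' by (simp add: pos_divide_le_eq mult.commute)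
    thus ?case using N_h_minus_w[of r] elim by (simp add: mult.assoc abs_le_iff del: abs_divide)
  qed
  have lim: "((\<lambda>r. u r powr (p - 1) / h r) \<longlongrightarrow> 0) at_top"
  proof (rule Lim_null_comparison[OF _ inv_h])
    show "\<forall>\<^sub>F r in at_top. norm (u r powr (p - 1) / h r) \<le> u 1 powr (p - 1) / h r"
      using eventually_ge_at_top[of 1]
    proof eventually_elim
      case (elim r)
      have "u r powr (p - 1) \<le> u 1 powr (p - 1)"
        using elim p u_pos[of r] u_antimono[of 1 r] by (intro powr_mono2) auto
      thus ?case using h_pos[of r] elim by (simp add: divide_right_mono)
    qed
  qed
  have w0: "((\<lambda>r. w r / h r) \<longlongrightarrow> 0) at_top"
  proof (rule tendsto_zero_of_linear_ode[where R=0 and A="\<lambda>r. u r powr (p - 1) / h r" and B="\<lambda>r. N * h r - w r + h' r / h r" and \<beta>=1])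
    fix r :: real assume r: "r > 0"
    show "((\<lambda>r. w r / h r) has_real_derivative u r powr (p - 1) / h r - (N * h r - w r + h' r / h r) * (w r / h r)) (at r)"
      using DERIV_divide[OF DERIV_w[OF r] h'(1)[OF r] h_nz[OF r]]
      by (rule DERIV_cong) (use h_nz[OF r] in \<open>simp add: field_simps\<close>)
  qed (use h_nz ev lim in \<open>auto intro!: continuous_on_add continuous_on_diff continuous_on_mult_left continuous_on_divide h_cont w_cont h'(2)\<close>)
  have h'0: "((\<lambda>r. h' r / (h r)\<^sup>2) \<longlongrightarrow> 0) at_top"
  proof (rule Lim_null_comparison[OF _ inv_h])
    show "\<forall>\<^sub>F r in at_top. norm (h' r / (h r)\<^sup>2) \<le> C / h r"
      using C eventually_gt_at_top[of 0]
    proof eventually_elim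
      case (elim r)
      thus ?case using h_pos[of r] by (simp add: power2_eq_square field_simps)
    qed
  qed
  have q: "((\<lambda>r. N - h' r / (h r)\<^sup>2 - p * (w r / h r)) \<longlongrightarrow> N - 0 - p * 0) at_top"
    by (intro tendsto_intros w0 h'0)
  (* The coefficient in the equation for h \<zeta> is h times a factor that tends to N. *)
  have B: "N * h r - h' r / h r - p * w r = h r * (N - h' r / (h r)\<^sup>2 - p * (w r / h r))" if "r > 0" for r
    using h_nz[OF that] by (simp add: field_simps power2_eq_square)
  show ?thesis
  proof (rule linear_ode_tendsto_quotient[where R=0 and A=h and B="\<lambda>r. N * h r - h' r / h r - p * w r" and \<beta>="1 * (N / 2)"])
    fix r :: real assume r: "r > 0"
    show "((\<lambda>r. h r * \<zeta> r) has_real_derivative h r - (N * h r - h' r / h r - p * w r) * (h r * \<zeta> r)) (at r)"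
      using DERIV_mult[OF h'(1)[OF r] DERIV_\<zeta>[OF r]]
      by (rule DERIV_cong) (use h_nz[OF r] in \<open>simp add: field_simps\<close>)
  next
    have "\<forall>\<^sub>F r in at_top. N - h' r / (h r)\<^sup>2 - p * (w r / h r) > N / 2"
      by (rule order_tendstoD[OF q]) (use N in simp)
    moreover have "\<forall>\<^sub>F r in at_top. h r \<ge> 1" using h by (simp add: filterlim_at_top)
    ultimately show "\<forall>\<^sub>F r in at_top. 1 * (N / 2) \<le> N * h r - h' r / h r - p * w r"
      using eventually_gt_at_top[of 0]
    proof eventually_elim
      case (elim r)
      show ?case unfolding B[OF elim(3)] using elim N by (intro mult_mono) auto
    qed
  next
    have "((\<lambda>r. 1 / (N - h' r / (h r)\<^sup>2 - p * (w r / h r))) \<longlongrightarrow> 1 / N) at_top"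
      using tendsto_divide[OF tendsto_const q, of 1] N by simp
    thus "((\<lambda>r. h r / (N * h r - h' r / h r - p * w r)) \<longlongrightarrow> 1 / N) at_top"
    proof (rule Lim_transform_eventually)
      show "\<forall>\<^sub>F r in at_top. 1 / (N - h' r / (h r)\<^sup>2 - p * (w r / h r)) = h r / (N * h r - h' r / h r - p * w r)"
        using eventually_gt_at_top[of 0] by eventually_elim (simp only: B, use h_nz in simp)
    qed
  qed (use N h_nz in \<open>auto intro!: continuous_on_diff continuous_on_mult_left continuous_on_divide h_cont w_cont h'(2)\<close>)
qed

lemma DERIV_u_powr:
  assumes "r > 0"
  shows "((\<lambda>r. u r powr (1 - p)) has_real_derivative (p - 1) * \<zeta> r) (at r)"
proof -
  have u: "u r > 0" using u_pos[OF assms] by simp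
  have "((\<lambda>r. u r powr (1 - p)) has_real_derivative (1 - p) * u r powr (- p) * u' r) (at r)"
    using DERIV_fun_powr[OF DERIV_u[OF assms] u, of "1 - p"] by simp
  thus ?thesis by (rule DERIV_cong) (simp add: \<zeta>_def powr_minus divide_inverse algebra_simps)
qed

lemma u_eq_powr_powr: "r > 0 \<Longrightarrow> (u r powr (1 - p)) powr (- (1 / (p - 1))) = u r"
proof -
  assume "r > 0"
  moreover have "(1 - p) * (- (1 / (p - 1))) = 1" using p by (simp add: field_simps)
  ultimately show ?thesis using u_pos[of r] by (simp only: powr_powr) simp
qed

text \<open>
  The function \<open>G\<close> is any scale on which \<open>u powr (1 - p)\<close> grows linearly: the integral of \<open>1 / h\<close>
  in general, and \<open>r\<close> itself if \<open>h\<close> has a finite limit.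
\<close>
lemma u_rate:
  assumes G: "filterlim G at_top at_top"
    and DERIV_G: "\<forall>\<^sub>F r in at_top. (G has_real_derivative g r) (at r)"
    and g: "\<forall>\<^sub>F r in at_top. g r \<noteq> 0"
    and lim: "((\<lambda>r. \<zeta> r / g r) \<longlongrightarrow> 1 / c) at_top" and c: "c > 0"
  shows "((\<lambda>r. G r powr (1 / (p - 1)) * u r) \<longlongrightarrow> (c / (p - 1)) powr (1 / (p - 1))) at_top"
proof -
  have "((\<lambda>r. u r powr (1 - p) / G r) \<longlongrightarrow> (p - 1) / c) at_top"
  proof (rule lhospital_at_top_at_top[where f'="\<lambda>r. (p - 1) * \<zeta> r" and g'=g])
    show "((\<lambda>r. (p - 1) * \<zeta> r / g r) \<longlongrightarrow> (p - 1) / c) at_top"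
      using tendsto_mult_left[OF lim, of "p - 1"] by simp
    show "\<forall>\<^sub>F r in at_top. ((\<lambda>r. u r powr (1 - p)) has_real_derivative (p - 1) * \<zeta> r) (at r)"
      using eventually_gt_at_top[of 0] by eventually_elim (rule DERIV_u_powr)
  qed (fact G DERIV_G g)+
  hence "((\<lambda>r. (u r powr (1 - p) / G r) powr (- (1 / (p - 1)))) \<longlongrightarrow> ((p - 1) / c) powr (- (1 / (p - 1)))) at_top"
    using p c by (intro tendsto_powr tendsto_const) auto
  moreover have "((p - 1) / c) powr (- (1 / (p - 1))) = (c / (p - 1)) powr (1 / (p - 1))"
    using p c by (simp add: powr_minus powr_divide)
  moreover have "\<forall>\<^sub>F r in at_top. (u r powr (1 - p) / G r) powr (- (1 / (p - 1))) = G r powr (1 / (p - 1)) * u r"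
    using eventually_gt_at_top[of 0] G[unfolded filterlim_at_top_dense, rule_format, of 0]
  proof eventually_elim
    case (elim r)
    note u_eq_powr_powr[OF elim(1)]
    moreover have "(u r powr (1 - p) / G r) powr (- (1 / (p - 1))) =
      (u r powr (1 - p)) powr (- (1 / (p - 1))) * G r powr (1 / (p - 1))"
      using elim u_pos[of r] by (simp add: powr_divide powr_minus field_simps del: powr_powr powr_eq_0_iff)
    ultimately show ?case by simp
  qed
  ultimately show ?thesis by (auto elim: Lim_transform_eventually)
qed

text \<open>
  Since \<open>h \<zeta>\<close> is bounded, the derivative \<open>(p - 1) \<zeta>\<close> of \<open>u powr (1 - p)\<close> is at most a multiple
  of \<open>1 / h = G'\<close>. So \<open>u powr (1 - p)\<close> stays bounded along with \<open>G\<close>, and \<open>u\<close> stays away from \<open>0\<close>.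
\<close>
lemma u_tendsto_positive:
  assumes lim: "((\<lambda>r. h r * \<zeta> r) \<longlongrightarrow> c) at_top"
    and G: "\<And>r. r > R \<Longrightarrow> (G has_real_derivative 1 / h r) (at r)" "\<And>r. r > R \<Longrightarrow> G r \<le> K"
  shows "\<exists>L>0. (u \<longlongrightarrow> L) at_top"
proof -
  have "\<forall>\<^sub>F r in at_top. h r * \<zeta> r < \<bar>c\<bar> + 1" by (rule order_tendstoD[OF lim]) simp
  then obtain T where T: "\<And>r. r \<ge> T \<Longrightarrow> h r * \<zeta> r < \<bar>c\<bar> + 1"
    by (auto simp: eventually_at_top_linorder)
  define C where "C = (p - 1) * (\<bar>c\<bar> + 1)"
  define S where "S = max T (max R 0) + 1"
  have S: "S > 0" "S > R" "S \<ge> T" by (auto simp: S_def)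
  define M where "M = u S powr (1 - p) - C * G S + C * K"
  have bound: "u r powr (1 - p) \<le> M" if r: "r \<ge> S" for r
  proof -
    have "u r powr (1 - p) - C * G r \<le> u S powr (1 - p) - C * G S"
    proof (rule DERIV_nonpos_imp_nonincreasing[OF r])
      fix x assume x: "S \<le> x" "x \<le> r"
      have "h x * \<zeta> x \<le> \<bar>c\<bar> + 1" using T[of x] S x by simp
      hence "\<zeta> x \<le> (\<bar>c\<bar> + 1) / h x" using h_pos[of x] S x by (simp add: field_simps)
      hence "(p - 1) * \<zeta> x \<le> (p - 1) * ((\<bar>c\<bar> + 1) / h x)" using p by (intro mult_left_mono) auto
      hence "(p - 1) * \<zeta> x - C * (1 / h x) \<le> 0" by (simp add: C_def)
      moreover have "((\<lambda>r. u r powr (1 - p) - C * G r) has_real_derivative (p - 1) * \<zeta> x - C * (1 / h x)) (at x)"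
        using S x by (intro DERIV_diff DERIV_u_powr DERIV_cmult G) auto
      ultimately show "\<exists>y. ((\<lambda>r. u r powr (1 - p) - C * G r) has_real_derivative y) (at x) \<and> y \<le> 0" by blast
    qed
    moreover have "C * G r \<le> C * K" using G(2)[of r] S r p by (intro mult_left_mono) (auto simp: C_def)
    ultimately show ?thesis by (simp add: M_def)
  qed
  have M: "M > 0" using bound[of S] u_pos[OF S(1)] by (smt (verit) powr_gt_zero)
  define b where "b = M powr (- (1 / (p - 1)))"
  have b: "b \<le> u r" if r: "r > S" for r
  proof -
    have "M powr (- (1 / (p - 1))) \<le> (u r powr (1 - p)) powr (- (1 / (p - 1)))"
      using bound[of r] r u_pos[of r] S p by (intro powr_mono2') auto
    also have "\<dots> = u r" using u_eq_powr_powr[of r] S r by simp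
    finally show ?thesis by (simp add: b_def)
  qed
  have "u s \<le> u r" if "S < r" "r \<le> s" for r s using u_antimono[of r s] S that by simp
  then obtain L where "(u \<longlongrightarrow> L) at_top" "b \<le> L"
    by (rule antimono_bounded_below_tendsto_at_top[of S u b]) (use b in auto)
  moreover have "b > 0" using M by (simp add: b_def)
  ultimately show ?thesis by (intro exI[of _ L]) auto
qed

lemma u_tendsto_0_of_rate:
  assumes G: "filterlim G at_top at_top"
    and rate: "((\<lambda>r. G r powr (1 / (p - 1)) * u r) \<longlongrightarrow> c) at_top"
  shows "(u \<longlongrightarrow> 0) at_top"
proof -
  have "((\<lambda>r. G r powr (- (1 / (p - 1)))) \<longlongrightarrow> 0) at_top"
    using p by (intro tendsto_neg_powr G) auto
  from tendsto_mult[OF this rate]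
  have "((\<lambda>r. G r powr (- (1 / (p - 1))) * (G r powr (1 / (p - 1)) * u r)) \<longlongrightarrow> 0) at_top" by simp
  moreover have "\<forall>\<^sub>F r in at_top. G r powr (- (1 / (p - 1))) * (G r powr (1 / (p - 1)) * u r) = u r"
    using G[unfolded filterlim_at_top_dense, rule_format, of 0]
    by eventually_elim (simp add: powr_minus)
  ultimately show ?thesis by (rule Lim_transform_eventually)
qed

end

section \<open>Convexity of a power of the volume and the Pohozaev energy\<close>

text \<open>
  The graph of \<open>f\<close> lies above its tangents; comparing the tangents at two points shows that \<open>f'\<close>
  is monotone.
\<close>
lemma convex_on_second_derivative_nonneg:
  fixes f f' :: "real \<Rightarrow> real"
  assumes convex: "convex_on {a..} f"
    and f': "\<And>x. x > a \<Longrightarrow> (f has_real_derivative f' x) (at x)"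
    and f'': "(f' has_real_derivative D) (at x)" and x: "x > a"
  shows "D \<ge> 0"
proof (rule mono_on_imp_deriv_nonneg[OF _ f''])
  have tangent: "f' c * (y - c) \<le> f y - f c" if "c > a" "y > a" for c y
    by (rule convex_on_imp_above_tangent[OF convex])
       (use that f' in \<open>auto intro: has_field_derivative_at_within\<close>)
  show "mono_on {a<..} f'"
  proof (rule mono_onI)
    fix s t assume st: "s \<in> {a<..}" "t \<in> {a<..}" "s \<le> t"
    have "0 \<le> (f' t - f' s) * (t - s)"
      using tangent[of s t] tangent[of t s] st by (simp add: algebra_simps)
    thus "f' s \<le> f' t" using st(3) by (cases "s = t") (auto simp: zero_le_mult_iff)
  qed
qed (use x in \<open>auto simp: interior_open\<close>)

text \<open>
  The second derivative of \<open>V powr a\<close> is \<open>a V powr (a - 2)\<close> times \<open>V m' - (1 - a) m\<^sup>2\<close>.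
\<close>
lemma volume_growth_of_convex_powr:
  fixes V m m' :: "real \<Rightarrow> real"
  assumes convex: "convex_on {0..} (\<lambda>r. V r powr a)" and a: "a > 0"
    and V: "\<And>r. r > 0 \<Longrightarrow> V r > 0" "\<And>r. r > 0 \<Longrightarrow> (V has_real_derivative m r) (at r)"
    and m: "\<And>r. r > 0 \<Longrightarrow> (m has_real_derivative m' r) (at r)"
    and r: "r > 0"
  shows "(1 - a) * (m r)\<^sup>2 \<le> V r * m' r"
proof -
  have D1: "((\<lambda>r. V r powr a) has_real_derivative a * V s powr (a - 1) * m s) (at s)" if "s > 0" for s
    using DERIV_fun_powr[OF V(2)[OF that] V(1)[OF that], of a] by simp
  have "((\<lambda>r. V r powr (a - 1)) has_real_derivative (a - 1) * V r powr (a - 1 - 1) * m r) (at r)"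
    using DERIV_fun_powr[OF V(2)[OF r] V(1)[OF r], of "a - 1"] by simp
  from DERIV_mult[OF DERIV_cmult[OF this, of a] m[OF r]]
  have D2: "((\<lambda>s. a * V s powr (a - 1) * m s) has_real_derivative
      a * ((a - 1) * V r powr (a - 1 - 1) * m r) * m r + m' r * (a * V r powr (a - 1))) (at r)" by simp
  have "0 \<le> a * ((a - 1) * V r powr (a - 1 - 1) * m r) * m r + m' r * (a * V r powr (a - 1))"
    by (rule convex_on_second_derivative_nonneg[OF convex D1 D2 r])
  also have "V r powr (a - 1) = V r powr (a - 1 - 1) * V r"
    using powr_add[of "V r" "a - 1 - 1" 1] V(1)[OF r] by simp
  finally have "0 \<le> (a * V r powr (a - 1 - 1)) * (V r * m' r - (1 - a) * (m r)\<^sup>2)"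
    by (simp add: algebra_simps power2_eq_square)
  moreover have "a * V r powr (a - 1 - 1) > 0" using a V(1)[OF r] by simp
  ultimately show ?thesis by (simp add: zero_le_mult_iff)
qed

text \<open>
  In the application \<open>m\<close> is the area density \<open>\<psi> ^ N\<close> and \<open>k = N h\<close> is its logarithmic derivative,
  so \<open>m u'\<close> is the flux of \<open>u\<close>. The Pohozaev energy \<open>P\<close> below has the derivative
  \<open>u'\<^sup>2 ((p + 3) / (2 (p + 1)) m - V k)\<close>: its potential terms cancel. The growth condition makes
  this nonpositive. From \<open>P \<le> 0\<close> comes \<open>V (- u') / 2 \<le> m u / (p + 1)\<close>, and the growth condition,
  used once more, bounds \<open>m\<close> by \<open>V k\<close>.
\<close>
lemma pohozaev_decay_bound:
  fixes V m k u u' :: "real \<Rightarrow> real" and p :: real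
  assumes p: "p > 1"
    and cont: "continuous_on {0..} V" "continuous_on {0..} m" "continuous_on {0..} u" "continuous_on {0..} u'"
    and zero: "V 0 = 0" "m 0 = 0"
    and V: "\<And>r. r > 0 \<Longrightarrow> V r > 0" "\<And>r. r > 0 \<Longrightarrow> (V has_real_derivative m r) (at r)"
    and m: "\<And>r. r > 0 \<Longrightarrow> m r > 0" "\<And>r. r > 0 \<Longrightarrow> (m has_real_derivative k r * m r) (at r)"
    and growth: "\<And>r. r > 0 \<Longrightarrow> (p + 3) / (2 * (p + 1)) * m r \<le> V r * k r"
    and u_pos: "\<And>r. r \<ge> 0 \<Longrightarrow> u r > 0"
    and u: "\<And>r. r > 0 \<Longrightarrow> (u has_real_derivative u' r) (at r)"
    and u': "\<And>r. r > 0 \<Longrightarrow> (u' has_real_derivative - (k r * u' r + u r powr p)) (at r)"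
    and r: "r > 0"
  shows "u' r < 0" and "- u' r \<le> 4 / (p + 3) * (k r * u r)"
proof -
  have DPow: "((\<lambda>r. u r powr (p + 1)) has_real_derivative (p + 1) * (u s powr p * u' s)) (at s)"
    and Pow: "u s powr (p + 1) = u s powr p * u s" if "s > 0" for s
    using DERIV_fun_powr[OF u[OF that], of "p + 1"] u_pos[of s] that powr_add[of "u s" p 1] by (simp_all add: mult.assoc)
  have flux: "((\<lambda>r. m r * u' r) has_real_derivative - (m s * u s powr p)) (at s)" if "s > 0" for s
    using DERIV_mult[OF m(2)[OF that] u'[OF that]] by (rule DERIV_cong) (simp add: algebra_simps)
  have "m 0 * u' 0 > m r * u' r"
  proof (rule DERIV_neg_imp_decreasing_open[OF r])
    fix x assume "0 < x" "x < r"
    thus "\<exists>y. ((\<lambda>r. m r * u' r) has_real_derivative y) (at x) \<and> y < 0"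
      using flux[of x] m(1)[of x] u_pos[of x] by (intro exI conjI) auto
  qed (intro continuous_on_mult continuous_on_subset[OF cont(2)] continuous_on_subset[OF cont(4)]; auto)
  hence "m r * u' r < 0" using zero by simp
  thus neg: "u' r < 0" using m(1)[OF r] by (simp add: mult_less_0_iff)
  define P where "P s = V s * ((u' s)\<^sup>2 / 2 + u s powr (p + 1) / (p + 1)) + m s * u' s * u s / (p + 1)" for s
  have DP: "(P has_real_derivative (u' s)\<^sup>2 * ((p + 3) / (2 * (p + 1)) * m s - V s * k s)) (at s)" if s: "s > 0" for s
  proof -
    have "((\<lambda>s. (u' s)\<^sup>2 / 2 + u s powr (p + 1) / (p + 1)) has_real_derivative
        u' s * - (k s * u' s + u s powr p) + u s powr p * u' s) (at s)"
      using DERIV_add[OF DERIV_cdivide[OF DERIV_power[OF u'[OF s], of 2], of 2] DERIV_cdivide[OF DPow[OF s], of "p + 1"]]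
      by (rule DERIV_cong) (use p in simp)
    note * = DERIV_add[OF DERIV_mult[OF V(2)[OF s] this] DERIV_cdivide[OF DERIV_mult[OF flux[OF s] u[OF s]], of "p + 1"]]
    (* Abbreviating 1 / (p + 1) makes the comparison of the two derivatives polynomial. *)
    define c where "c = 1 / (p + 1)"
    have c: "x / (p + 1) = c * x" "(p + 3) / (2 * (p + 1)) = 1 / 2 + c" for x
      using p by (simp_all add: c_def field_simps)
    show ?thesis unfolding P_def[abs_def]
      by (rule DERIV_cong[OF *], unfold Pow[OF s] c) (simp add: algebra_simps power2_eq_square)
  qed
  have "P r \<le> P 0"
  proof (rule DERIV_nonpos_imp_decreasing_open[where f=P])
    fix x assume x: "0 < x" "x < r"
    show "\<exists>y. (P has_real_derivative y) (at x) \<and> y \<le> 0"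
      using DP[OF x(1)] growth[OF x(1)] by (intro exI conjI) (auto intro: mult_nonneg_nonpos)
    next
    have [continuous_intros]: "continuous_on {0..r} V" "continuous_on {0..r} m" "continuous_on {0..r} u" "continuous_on {0..r} u'"
      by (auto intro: cont[THEN continuous_on_subset])
    show "continuous_on {0..r} P" unfolding P_def
      by (intro continuous_intros) (use u_pos p in \<open>auto simp: less_imp_neq[symmetric]\<close>)
  qed (use r in simp)
  hence "V r * ((u' r)\<^sup>2 / 2 + u r powr (p + 1) / (p + 1)) + m r * u' r * u r / (p + 1) \<le> 0"
    using zero by (simp add: P_def)
  moreover have "V r * (u r powr (p + 1) / (p + 1)) \<ge> 0" using V(1)[OF r] p by simp
  ultimately have "V r * (u' r)\<^sup>2 / 2 + m r * u' r * u r / (p + 1) \<le> 0" by (simp add: distrib_left)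
  (* The surviving terms share the positive factor - u'. *)
  hence "(- u' r) * (V r * - u' r / 2) \<le> (- u' r) * (m r * u r / (p + 1))"
    by (simp add: power2_eq_square algebra_simps)
  hence 1: "V r * - u' r / 2 \<le> m r * u r / (p + 1)" using neg by (simp only: mult_le_cancel_left_pos neg_0_less_iff_less)
  have "m r \<le> 2 * (p + 1) / (p + 3) * (V r * k r)" using growth[OF r] p by (simp add: field_simps)
  hence "m r * (u r / (p + 1)) \<le> 2 * (p + 1) / (p + 3) * (V r * k r) * (u r / (p + 1))"
    using u_pos[of r] r p by (intro mult_right_mono) auto
  also have "\<dots> = V r * (2 / (p + 3) * (k r * u r)) * ((p + 1) / (p + 1))"
    by (simp only: divide_inverse mult_ac)
  also have "(p + 1) / (p + 1) = 1" using p by simp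
  finally have "V r * (- u' r / 2) \<le> V r * (2 / (p + 3) * (k r * u r))" using 1 by simp
  hence "- u' r / 2 \<le> 2 / (p + 3) * (k r * u r)" using V(1)[OF r] by (simp only: mult_le_cancel_left_pos)
  thus "- u' r \<le> 4 / (p + 3) * (k r * u r)" by simp
qed

section \<open>Integrability on a half-line\<close>

text \<open>
  Translates Lebesgue integrability of a continuous nonnegative function into a bound on its
  antiderivative, the form in which the equation uses it.
\<close>
lemma set_integrable_halfline_iff_bounded:
  fixes g :: "real \<Rightarrow> real"
  assumes cont: "continuous_on {a..} g" and nonneg: "\<And>x. x \<ge> a \<Longrightarrow> g x \<ge> 0"
  shows "set_integrable lborel {a<..} g \<longleftrightarrow> (\<exists>K. \<forall>r\<ge>a. integral {a..r} g \<le> K)"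
proof
  assume int: "set_integrable lborel {a<..} g"
  have "integral {a..r} g \<le> integral {a<..} g" if "r \<ge> a" for r
  proof -
    have "integral {a..r} g = integral {a<..r} g"
      by (rule integral_subset_negligible[symmetric])
         (auto intro: negligible_subset[of "{a}"])
    also have "\<dots> \<le> integral {a<..} g"
      by (intro integral_subset_le set_borel_integral_eq_integral set_integrable_subset[OF int]) (use nonneg int in \<open>auto intro: set_borel_integral_eq_integral\<close>)
    finally show ?thesis .
  qed
  thus "\<exists>K. \<forall>r\<ge>a. integral {a..r} g \<le> K" by blast
next
  assume "\<exists>K. \<forall>r\<ge>a. integral {a..r} g \<le> K"
  then obtain K where K: "\<And>r. r \<ge> a \<Longrightarrow> integral {a..r} g \<le> K" by blast
  define G where "G r = integral {a..r} g" for r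
  have int: "g integrable_on {a..r}" for r
    by (rule integrable_continuous_interval) (rule continuous_on_subset[OF cont], auto)
  have mono: "G r \<le> G s" if "r \<le> s" for r s unfolding G_def
    by (rule integral_subset_le) (use that int nonneg in auto)
  have DG: "(G has_real_derivative g r) (at r)" if "r > a" for r
    unfolding G_def by (rule DERIV_integral_upper_limit[OF cont that])
  have contG: "continuous_on {a..b} G" for b
    unfolding G_def by (rule indefinite_integral_continuous_1[OF int])
  have "(G \<longlongrightarrow> G a) (at a within {a..a+1})" using contG[of "a + 1"] by (auto simp: continuous_on_def)
  hence "(G \<longlongrightarrow> G a) (at_right a)" by (simp add: at_within_Icc_at_right)
  moreover obtain L where "(G \<longlongrightarrow> L) at_top"
  proof -
    have "((\<lambda>r. G r) \<longlongrightarrow> Sup (G ` {a..})) at_top"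
    proof (rule increasing_tendsto)
      have bdd: "bdd_above (G ` {a..})" using K by (auto intro!: bdd_aboveI2 simp: G_def)
      show "\<forall>\<^sub>F r in at_top. G r \<le> Sup (G ` {a..})"
        using eventually_ge_at_top[of a] by eventually_elim (use bdd in \<open>auto intro!: cSup_upper\<close>)
      fix x assume "x < Sup (G ` {a..})"
      then obtain r where r: "r \<ge> a" "x < G r"
        by (subst (asm) less_cSup_iff) (use bdd in auto)
      show "\<forall>\<^sub>F s in at_top. x < G s"
        using eventually_ge_at_top[of r] by eventually_elim (use mono r in force)
    qed
    thus ?thesis using that by blast
  qed
  ultimately have "set_integrable lborel (einterval (ereal a) \<infinity>) g"
    using DG nonneg continuous_on_interior[OF cont]
    by (intro interval_integral_FTC_nonneg(1)[where F=G and A="G a" and B=L])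
       (auto simp: ereal_tendsto_simps)
  thus "set_integrable lborel {a<..} g" by (simp add: einterval_def greaterThan_def)
qed

section \<open>Radial solutions on the model manifold\<close>

text \<open>
  Restricting \<open>v\<close> to the line through the pole in direction \<open>e\<close> shows that \<open>u\<close> is twice
  differentiable, and that its derivative extends continuously to the pole; the gradient of \<open>v\<close>
  supplies \<open>u'\<close>, its Hessian \<open>u''\<close>.
\<close>
lemma radial_solution_ode:
  fixes \<psi> \<psi>' :: "real \<Rightarrow> real" and v :: "real ^ 'n \<Rightarrow> real" and u :: "real \<Rightarrow> real"
  assumes pos: "\<And>r. r > 0 \<Longrightarrow> \<psi> r > 0"
    and \<psi>': "\<And>r. r > 0 \<Longrightarrow> (\<psi> has_real_derivative \<psi>' r) (at r)"
    and solution: "positive_solution \<psi> p v"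
    and radial: "\<And>x. v x = u (norm x)"
  obtains u' where "continuous_on {0..} u" "continuous_on {0..} u'" "\<And>r. r \<ge> 0 \<Longrightarrow> u r > 0"
    "\<And>r. r > 0 \<Longrightarrow> (u has_real_derivative u' r) (at r)"
    "\<And>r. r > 0 \<Longrightarrow>
       (u' has_real_derivative - ((real CARD('n) - 1) * (\<psi>' r / \<psi> r) * u' r + u r powr p)) (at r)"
proof -
  obtain k :: 'n where True by auto
  define e :: "real ^ 'n" where "e = axis k 1"
  have norm_e: "norm e = 1" by (simp add: e_def)
  obtain G H where G: "\<And>x. (v has_derivative (\<lambda>h. G x \<bullet> h)) (at x)"
    and H: "\<And>x. (G has_derivative (\<lambda>h. H x *v h)) (at x)"
    using solution unfolding positive_solution_def C2_function_def by blast
  define u' where "u' r = G (r *\<^sub>R e) \<bullet> e" for r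
  define u'' where "u'' r = (H (r *\<^sub>R e) *v e) \<bullet> e" for r
  have ray: "((\<lambda>r. r *\<^sub>R e) has_derivative (\<lambda>h. h *\<^sub>R e)) (at r)" for r
    by (auto intro!: derivative_eq_intros)
  have v_ray: "((\<lambda>r. v (r *\<^sub>R e)) has_real_derivative u' r) (at r)" for r
    unfolding has_field_derivative_def using has_derivative_compose[OF ray G]
    by (rule has_derivative_eq_rhs) (auto simp: u'_def)
  have D': "(u' has_real_derivative u'' r) (at r)" for r
    unfolding has_field_derivative_def u'_def
    using has_derivative_inner_left[OF has_derivative_compose[OF ray H]]
    by (rule has_derivative_eq_rhs) (auto simp: u''_def matrix_vector_mult_scaleR)
  have D: "(u has_real_derivative u' r) (at r)" if "r > 0" for r
    using v_ray
  proof (rule DERIV_cong_ev[OF refl _ refl, THEN iffD1, rotated])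
    show "\<forall>\<^sub>F r in nhds r. v (r *\<^sub>R e) = u r"
      using eventually_nhds_in_open[of "{0<..}" r] that
      by (auto elim!: eventually_mono simp: radial norm_e)
  qed
  have "continuous_on {0..} (\<lambda>r. v (r *\<^sub>R e))"
    by (rule DERIV_continuous_on) (rule has_field_derivative_at_within[OF v_ray])
  hence "continuous_on {0..} u"
    by (rule continuous_on_cong[THEN iffD1, OF refl, rotated]) (simp add: radial norm_e)
  moreover have "continuous_on {0..} u'"
    by (rule DERIV_continuous_on) (rule has_field_derivative_at_within[OF D'])
  moreover have u_pos: "u r > 0" if "r \<ge> 0" for r
    using solution radial[of "r *\<^sub>R e"] that unfolding positive_solution_def by (simp add: norm_e) metis
  moreover have "(u' has_real_derivative - ((real CARD('n) - 1) * (\<psi>' r / \<psi> r) * u' r + u r powr p)) (at r)"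
    if r: "r > 0" for r
  proof -
    have nr: "norm (r *\<^sub>R e) = r" using r by (simp add: norm_e)
    have "laplace_beltrami (model_metric \<psi>) (\<lambda>x. u (norm x)) (r *\<^sub>R e) =
        u'' r + (real CARD('n) - 1) * (\<psi>' r / \<psi> (norm (r *\<^sub>R e))) * u' (norm (r *\<^sub>R e))"
      by (rule laplace_beltrami_radial) (use r D D' pos \<psi>' nr in \<open>auto simp: e_def axis_eq_0_iff\<close>)
    moreover have "v = (\<lambda>x. u (norm x))" using radial by auto
    moreover have "- laplace_beltrami (model_metric \<psi>) v (r *\<^sub>R e) = \<bar>u r\<bar> powr (p - 1) * u r"
      using solution r unfolding positive_solution_def by (simp add: radial norm_e)
    moreover have "\<bar>u r\<bar> powr (p - 1) * u r = u r powr p"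
      using u_pos[of r] r powr_add[of "u r" "p - 1" 1] by simp
    ultimately have "u'' r = - ((real CARD('n) - 1) * (\<psi>' r / \<psi> r) * u' r + u r powr p)"
      using r by (simp add: norm_e)
    thus ?thesis using D'[of r] by simp
  qed
  ultimately show thesis using that[of u'] D by blast
qed

text \<open>
  The Pohozaev bound places \<open>u\<close> in the locale \<open>radial_lane_emden\<close> with \<open>\<kappa> = 4 / (p + 3)\<close>. The
  growth condition also gives \<open>h > 0\<close> on all of \<open>{0<..}\<close>.
\<close>
theorem theorem2p9:
  fixes \<psi> \<psi>' \<psi>'' :: "real \<Rightarrow> real" and p r\<^sub>0 :: real and l :: ereal
    and v :: "real ^ 'n \<Rightarrow> real" and u :: "real \<Rightarrow> real"
  assumes n: "CARD('n) \<ge> 3"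
    and p: "p \<ge> (real CARD('n) + 2) / (real CARD('n) - 2)"
    and C2: "C2_halfline \<psi> \<psi>' \<psi>''"
    and pos: "\<And>r. r > 0 \<Longrightarrow> \<psi> r > 0"
    and at_pole: "\<psi> 0 = 0" "\<psi>'' 0 = 0" "\<psi>' 0 = 1"
    and nondecreasing: "\<And>r. r > 0 \<Longrightarrow> \<psi>' r \<ge> 0"
    and l: "0 < l" "((\<lambda>r. ereal (\<psi>' r / \<psi> r)) \<longlongrightarrow> l) at_top"
    and A_convex: "convex_on {0..}
      (\<lambda>r. (integral {0..r} (\<lambda>s. \<psi> s ^ (CARD('n) - 1))) powr ((p - 1) / (2 * (p + 1))))"
    and log_deriv: "l = \<infinity> \<Longrightarrow> deriv (\<lambda>r. ln (\<psi>' r / \<psi> r)) \<in> O[at_top](\<lambda>_. 1)"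
    and r0: "r\<^sub>0 \<ge> 0" "\<And>r. r \<ge> r\<^sub>0 \<Longrightarrow> \<psi>' r > 0"
    and solution: "positive_solution \<psi> p v"
    and radial: "\<And>x. v x = u (norm x)"
  shows "(set_integrable lborel {r\<^sub>0<..} (\<lambda>r. \<psi> r / \<psi>' r) \<longrightarrow>
            (\<exists>L::real. L > 0 \<and> (u \<longlongrightarrow> L) at_top))
    \<and> (\<not> set_integrable lborel {r\<^sub>0<..} (\<lambda>r. \<psi> r / \<psi>' r) \<longrightarrow>
            (u \<longlongrightarrow> 0) at_top \<and>
            ((\<lambda>r. (integral {r\<^sub>0..r} (\<lambda>s. \<psi> s / \<psi>' s)) powr (1 / (p - 1)) * u r)
              \<longlongrightarrow> ((real CARD('n) - 1) / (p - 1)) powr (1 / (p - 1))) at_top)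
    \<and> (l < \<infinity> \<longrightarrow>
            ((\<lambda>r. r powr (1 / (p - 1)) * u r)
              \<longlongrightarrow> (real_of_ereal l * (real CARD('n) - 1) / (p - 1)) powr (1 / (p - 1))) at_top)"
proof -
  define N where "N = real CARD('n) - 1"
  have N: "N > 0" using n by (simp add: N_def)
  have "1 < (real CARD('n) + 2) / (real CARD('n) - 2)" using n by (simp add: field_simps)
  hence p1: "p > 1" using p by linarith
  have D\<psi>: "(\<psi> has_real_derivative \<psi>' r) (at r)" and D\<psi>': "(\<psi>' has_real_derivative \<psi>'' r) (at r)"
    if "r > 0" for r
  proof -
    have "at r within {0..} = at r" by (rule at_within_interior) (use that in simp)
    thus "(\<psi> has_real_derivative \<psi>' r) (at r)" "(\<psi>' has_real_derivative \<psi>'' r) (at r)"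
      using C2 that by (auto simp: C2_halfline_def dest: spec[of _ r])
  qed
  have cont\<psi>: "continuous_on {0..} \<psi>" "continuous_on {0..} \<psi>'" "continuous_on {0..} \<psi>''"
    using C2 unfolding C2_halfline_def by (auto intro: DERIV_continuous_on)
  obtain u' where contu: "continuous_on {0..} u" "continuous_on {0..} u'"
    and u_pos: "\<And>r. r \<ge> 0 \<Longrightarrow> u r > 0"
    and Du: "\<And>r. r > 0 \<Longrightarrow> (u has_real_derivative u' r) (at r)"
    and Du': "\<And>r. r > 0 \<Longrightarrow> (u' has_real_derivative - (N * (\<psi>' r / \<psi> r) * u' r + u r powr p)) (at r)"
    using radial_solution_ode[OF pos D\<psi> solution radial] unfolding N_def by blast

  define h where "h r = \<psi>' r / \<psi> r" for r
  define m where "m r = \<psi> r ^ (CARD('n) - 1)" for r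
  define V where "V r = integral {0..r} m" for r
  have contm: "continuous_on {0..} m" unfolding m_def by (intro continuous_intros cont\<psi>)
  have m_pos: "m r > 0" if "r > 0" for r using pos[OF that] by (simp add: m_def)
  have Dm: "(m has_real_derivative N * h r * m r) (at r)" if "r > 0" for r
  proof -
    obtain j where j: "CARD('n) - 1 = Suc j" "N = real (Suc j)" using n
      by (intro that[of "CARD('n) - 2"]) (auto simp: N_def)
    show ?thesis unfolding m_def[abs_def] j
      by (rule DERIV_cong[OF DERIV_power[OF D\<psi>[OF that]]])
         (use pos[OF that] in \<open>simp add: h_def\<close>)
  qed
  have DV: "(V has_real_derivative m r) (at r)" if "r > 0" for r
    unfolding V_def by (rule DERIV_integral_upper_limit[OF contm that])
  have contV_Icc: "continuous_on {0..b} V" for b unfolding V_def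
    by (intro indefinite_integral_continuous_1 integrable_continuous_interval continuous_on_subset[OF contm]) auto
  have contV: "continuous_on {0..} V"
  proof (rule continuous_on_eq_continuous_within[THEN iffD2], rule ballI)
    fix x :: real assume "x \<in> {0..}"
    hence "continuous (at x within {0..x + 1}) V"
      using contV_Icc[of "x + 1"] by (simp add: continuous_on_eq_continuous_within)
    moreover have "at x within {0..x + 1} = at x within {0..}"
      by (rule at_within_nhd[of x "{..<x + 1}"]) auto
    ultimately show "continuous (at x within {0..}) V" by simp
  qed
  have V0: "V 0 = 0" and m0: "m 0 = 0" using n at_pole by (simp_all add: V_def m_def)
  have V_pos: "V r > 0" if "r > 0" for r
  proof -
    have "V 0 < V r"
      by (rule DERIV_pos_imp_increasing_open[OF that _ contV_Icc]) (use DV m_pos in blast)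
    thus ?thesis using V0 by simp
  qed
  have a: "1 - (p - 1) / (2 * (p + 1)) = (p + 3) / (2 * (p + 1))" using p1 by (simp add: field_simps)
  have growth: "(p + 3) / (2 * (p + 1)) * m r \<le> V r * (N * h r)" if "r > 0" for r
  proof -
    have "(1 - (p - 1) / (2 * (p + 1))) * (m r)\<^sup>2 \<le> V r * (N * h r * m r)"
      by (rule volume_growth_of_convex_powr[OF _ _ V_pos DV Dm that])
         (use A_convex p1 in \<open>auto simp: V_def m_def[abs_def]\<close>)
    hence "m r * ((p + 3) / (2 * (p + 1)) * m r) \<le> m r * (V r * (N * h r))"
      unfolding a by (simp add: power2_eq_square mult_ac)
    thus ?thesis using m_pos[OF that] by (simp only: mult_le_cancel_left_pos)
  qed
  have h_pos: "h r > 0" if "r > 0" for r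
  proof -
    have "0 < (p + 3) / (2 * (p + 1)) * m r" using p1 m_pos[OF that] by simp
    hence "0 < V r * (N * h r)" using growth[OF that] by linarith
    thus ?thesis using V_pos[OF that] N by (simp add: zero_less_mult_iff)
  qed
  have conth: "continuous_on {0<..} h" unfolding h_def
    by (intro continuous_on_divide continuous_on_subset[OF cont\<psi>(1)] continuous_on_subset[OF cont\<psi>(2)])
       (use pos in \<open>force+\<close>)
  note pohozaev = pohozaev_decay_bound[OF p1 contV contm contu V0 m0 V_pos DV m_pos Dm growth u_pos Du Du'[folded h_def]]
  interpret radial_lane_emden N p "4 / (p + 3)" h u u'
    using N p1 h_pos conth u_pos pohozaev Du Du'[folded h_def] by unfold_locales auto

  have lim: "((\<lambda>r. h r * \<zeta> r) \<longlongrightarrow> 1 / N) at_top"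
  proof (cases "l = \<infinity>")
    case True
    define h' where "h' r = (\<psi>'' r * \<psi> r - \<psi>' r * \<psi>' r) / (\<psi> r * \<psi> r)" for r
    have Dh: "(h has_real_derivative h' r) (at r)" if "r > 0" for r
      unfolding h_def[abs_def] h'_def using pos[OF that]
      by (intro DERIV_divide D\<psi> D\<psi>' that) simp
    have conth': "continuous_on {0<..} h'" unfolding h'_def
      by (intro continuous_on_divide continuous_on_diff continuous_on_mult continuous_on_subset[OF cont\<psi>(1)]
            continuous_on_subset[OF cont\<psi>(2)] continuous_on_subset[OF cont\<psi>(3)])
         (use pos in \<open>force+\<close>)
    have h_top: "filterlim h at_top at_top"
      using l(2) True by (simp add: h_def[abs_def] tendsto_PInfty_eq_at_top)
    obtain C where C: "\<forall>\<^sub>F r in at_top. \<bar>deriv (\<lambda>r. ln (h r)) r\<bar> \<le> C"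
      using log_deriv[OF True] by (elim landau_o.bigE) (auto simp: h_def)
    have "\<forall>\<^sub>F r in at_top. \<bar>h' r / h r\<bar> \<le> C"
      using C eventually_gt_at_top[of 0]
    proof eventually_elim
      case (elim r)
      have "((\<lambda>r. ln (h r)) has_real_derivative 1 / h r * h' r) (at r)"
        using DERIV_chain2[OF DERIV_ln_divide[OF h_pos] Dh] elim by simp
      hence "deriv (\<lambda>r. ln (h r)) r = h' r / h r" by (simp add: DERIV_imp_deriv)
      thus ?case using elim by simp
    qed
    thus ?thesis by (rule h_\<zeta>_tendsto_infinite[OF h_top _ conth', rotated]) (rule Dh)
  next
    case False
    then obtain L where L: "l = ereal L" using l(1) by (cases l) auto
    thus ?thesis using l by (intro h_\<zeta>_tendsto_finite[of L]) (auto simp: h_def[abs_def])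
  qed

  define G where "G r = integral {r\<^sub>0..r} (\<lambda>s. \<psi> s / \<psi>' s)" for r
  have contg: "continuous_on {r\<^sub>0..} (\<lambda>s. \<psi> s / \<psi>' s)"
    by (intro continuous_on_divide continuous_on_subset[OF cont\<psi>(1)] continuous_on_subset[OF cont\<psi>(2)])
       (use r0 in \<open>force+\<close>)
  (* If r0 = 0, the integrand at the left endpoint is \<psi> 0 / \<psi>' 0 = 0 / 1. *)
  have g_nonneg: "\<psi> s / \<psi>' s \<ge> 0" if "s \<ge> r\<^sub>0" for s
    using r0 that pos[of s] at_pole by (cases "s = 0") (force intro: divide_nonneg_pos)+
  have DG: "(G has_real_derivative 1 / h r) (at r)" if "r > r\<^sub>0" for r
    unfolding G_def h_def using DERIV_integral_upper_limit[OF contg that] by simp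
  have int_iff: "set_integrable lborel {r\<^sub>0<..} (\<lambda>r. \<psi> r / \<psi>' r) \<longleftrightarrow> (\<exists>K. \<forall>r\<ge>r\<^sub>0. G r \<le> K)"
    unfolding G_def by (rule set_integrable_halfline_iff_bounded[OF contg g_nonneg])

  have "\<exists>L>0. (u \<longlongrightarrow> L) at_top"
    if int: "set_integrable lborel {r\<^sub>0<..} (\<lambda>r. \<psi> r / \<psi>' r)"
  proof -
    obtain K where "\<And>r. r \<ge> r\<^sub>0 \<Longrightarrow> G r \<le> K" using int int_iff by blast
    thus ?thesis by (intro u_tendsto_positive[OF lim, where R="r\<^sub>0" and G=G and K=K] DG) auto
  qed
  moreover have "(u \<longlongrightarrow> 0) at_top \<and>
      ((\<lambda>r. G r powr (1 / (p - 1)) * u r) \<longlongrightarrow> (N / (p - 1)) powr (1 / (p - 1))) at_top"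
    if not_int: "\<not> set_integrable lborel {r\<^sub>0<..} (\<lambda>r. \<psi> r / \<psi>' r)"
  proof -
    have G_mono: "G r \<le> G s" if "r \<le> s" for r s unfolding G_def
      by (rule integral_subset_le)
         (use that g_nonneg in \<open>auto intro!: integrable_continuous_interval continuous_on_subset[OF contg]\<close>)
    have G_top: "filterlim G at_top at_top" unfolding filterlim_at_top
    proof
      fix K
      obtain r where r: "G r > K" using not_int int_iff by (meson not_le)
      show "\<forall>\<^sub>F s in at_top. K \<le> G s"
        using eventually_ge_at_top[of r] by eventually_elim (use r G_mono[of r] in force)
    qed
    have ev_DG: "\<forall>\<^sub>F r in at_top. (G has_real_derivative 1 / h r) (at r)"
      using eventually_gt_at_top[of r\<^sub>0] by eventually_elim (rule DG)
    have ev_nz: "\<forall>\<^sub>F r in at_top. 1 / h r \<noteq> 0"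
      using eventually_gt_at_top[of 0] by eventually_elim (use h_pos in force)
    have "((\<lambda>r. \<zeta> r / (1 / h r)) \<longlongrightarrow> 1 / N) at_top" using lim by (simp add: mult.commute)
    note rate = u_rate[OF G_top ev_DG ev_nz this N]
    from u_tendsto_0_of_rate[OF G_top rate] rate show ?thesis by simp
  qed
  moreover have "((\<lambda>r. r powr (1 / (p - 1)) * u r)
      \<longlongrightarrow> (real_of_ereal l * N / (p - 1)) powr (1 / (p - 1))) at_top" if finite: "l < \<infinity>"
  proof -
    obtain L where L: "l = ereal L" using l(1) finite by (cases l) auto
    have hL: "(h \<longlongrightarrow> L) at_top" and "L > 0" using l L by (auto simp: h_def[abs_def])
    have "((\<lambda>r. h r * \<zeta> r / h r) \<longlongrightarrow> (1 / N) / L) at_top"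
      using \<open>L > 0\<close> by (intro tendsto_divide lim hL) simp
    moreover have "\<forall>\<^sub>F r in at_top. h r * \<zeta> r / h r = \<zeta> r / 1"
      using eventually_gt_at_top[of 0] by eventually_elim (use h_pos in force)
    ultimately have "((\<lambda>r. \<zeta> r / 1) \<longlongrightarrow> (1 / N) / L) at_top" by (rule Lim_transform_eventually)
    hence "((\<lambda>r. \<zeta> r / 1) \<longlongrightarrow> 1 / (L * N)) at_top" by (simp add: mult.commute)
    hence "((\<lambda>r. r powr (1 / (p - 1)) * u r) \<longlongrightarrow> (L * N / (p - 1)) powr (1 / (p - 1))) at_top"
      by (rule u_rate[OF filterlim_ident, rotated 2]) (use N \<open>L > 0\<close> in auto)
    thus ?thesis by (simp add: L)
  qed
  ultimately show ?thesis unfolding G_def N_def by blast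
qed

end
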